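(* Let $\lambda\in\mathbb{R}$, let $\alpha$ be a positive integer and let $m\in\mathbb{N}$ with $m\ge\alpha$. Then \begin{align*} \frac{1}{\alpha+1}\big(\beta_{\alpha+1,\lambda}(m+1)-\beta_{\alpha+1,\lambda}(\alpha)\big)&=\sum_{k=1}^{m}\binom{m}{k}(k-1)!\Big\{S_{2,\lambda}(\alpha+1,k)+\alpha\lambda\, S_{2,\lambda}(\alpha,k)\Big\}\\ &\quad-\sum_{k=1}^{\alpha-1}\binom{\alpha-1}{k}(k-1)!\Big\{S_{2,\lambda}(\alpha+1,k)+\alpha\lambda\, S_{2,\lambda}(\alpha,k)\Big\}. \end{align*}
   Context: For $\lambda\in\mathbb{R}$, the generalized falling factorial polynomials are $(x)_{0,\lambda}=1$ and $(x)_{n,\lambda}=x(x-\lambda)\cdots(x-(n-1)\lambda)$ for $n\ge1$; the ordinary falling factorial is $(x)_0=1$, $(x)_n=x(x-1)\cdots(x-n+1)$. The degenerate exponential is the formal power series $e_{\lambda}^{x}(t)=\sum_{n=0}^{\infty}(x)_{n,\lambda}\frac{t^{n}}{n!}$, and $e_\lambda(t)=e_\lambda^1(t)$. The degenerate Bernoulli polynomials $\beta_{n,\lambda}(x)$ are defined by $\frac{t}{e_{\lambda}(t)-1}e_{\lambda}^{x}(t)=\sum_{n=0}^{\infty}\beta_{n,\lambda}(x)\frac{t^{n}}{n!}$. The degenerate Stirling numbers of the second kind $S_{2,\lambda}(n,k)$ are defined by $(x)_{n,\lambda}=\sum_{k=0}^{n}S_{2,\lambda}(n,k)(x)_{k}$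 for all $n\ge 0$, with $S_{2,\lambda}(n,k)=0$ for $k>n$ or $k<0$. *)

theory Defs
  imports Complex_Main "HOL-Computational_Algebra.Formal_Power_Series"
begin

definition gen_ffact :: "real \<Rightarrow> real \<Rightarrow> nat \<Rightarrow> real" where
  "gen_ffact l x n = (\<Prod>i<n. x - real i * l)"

definition ffact :: "real \<Rightarrow> nat \<Rightarrow> real" where
  "ffact x n = (\<Prod>i<n. x - real i)"

definition dexp :: "real \<Rightarrow> real \<Rightarrow> real fps" where
  "dexp l x = Abs_fps (\<lambda>n. gen_ffact l x n / fact n)"

text \<open>The denominator \<open>dexp l 1 - 1\<close> has subdegree 1, so the quotient below is an exact
  quotient of formal power series; see \<open>dexp_quotient_exact\<close>.\<close>

definition deg_bernoulli :: "nat \<Rightarrow> real \<Rightarrow> real \<Rightarrow> real" where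
  "deg_bernoulli n l x = fact n * fps_nth (fps_X / (dexp l 1 - 1) * dexp l x) n"

definition is_deg_stirling2 :: "real \<Rightarrow> (nat \<Rightarrow> nat \<Rightarrow> real) \<Rightarrow> bool" where
  "is_deg_stirling2 l S \<longleftrightarrow>
     (\<forall>n x. gen_ffact l x n = (\<Sum>k=0..n. S n k * ffact x k)) \<and>
     (\<forall>n k. n < k \<longrightarrow> S n k = 0)"

text \<open>The description is proper: see \<open>ex1_is_deg_stirling2\<close>.\<close>

definition deg_stirling2 :: "real \<Rightarrow> nat \<Rightarrow> nat \<Rightarrow> real" where
  "deg_stirling2 l = (THE S. is_deg_stirling2 l S)"

lemma dexp_quotient_exact: "fps_X / (dexp l 1 - 1) * (dexp l 1 - 1) = fps_X"
proof -
  have nth: "fps_nth (dexp l 1 - 1) 0 = 0" "fps_nth (dexp l 1 - 1) 1 = 1"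
    by (simp_all add: dexp_def gen_ffact_def)
  then have nz: "dexp l 1 - 1 \<noteq> 0"
    by (metis fps_zero_nth zero_neq_one)
  have "subdegree (dexp l 1 - 1) \<le> 1"
    by (rule subdegree_leI) (use nth in simp)
  then have "dexp l 1 - 1 dvd fps_X"
    using nz by (simp add: fps_dvd_iff)
  then show ?thesis
    by simp
qed

fun deg_stirling2_rec :: "real \<Rightarrow> nat \<Rightarrow> nat \<Rightarrow> real" where
  "deg_stirling2_rec l 0 k = (if k = 0 then 1 else 0)"
| "deg_stirling2_rec l (Suc n) k =
     (if k = 0 then 0 else deg_stirling2_rec l n (k - 1))
     + (real k - real n * l) * deg_stirling2_rec l n k"

lemma is_deg_stirling2_rec: "is_deg_stirling2 l (deg_stirling2_rec l)"
proof -
  let ?S = "deg_stirling2_rec l"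
  have zero: "?S n k = 0" if "n < k" for n k
    using that by (induction n arbitrary: k) auto
  have "gen_ffact l x n = (\<Sum>k=0..n. ?S n k * ffact x k)" for n x
  proof (induction n)
    case 0
    show ?case by (simp add: gen_ffact_def ffact_def)
  next
    case (Suc n)
    have ff: "ffact x k * (x - real n * l)
        = ffact x (Suc k) + (real k - real n * l) * ffact x k" for k
      by (simp add: ffact_def algebra_simps)
    have "gen_ffact l x (Suc n) = gen_ffact l x n * (x - real n * l)"
      by (simp add: gen_ffact_def)
    also have "\<dots> = (\<Sum>k=0..n. ?S n k * (ffact x k * (x - real n * l)))"
      by (simp add: Suc sum_distrib_right mult.assoc)
    also have "\<dots> = (\<Sum>k=0..n. ?S n k * ffact x (Suc k))
        + (\<Sum>k=0..n. (real k - real n * l) * ?S n k * ffact x k)"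
      unfolding ff sum.distrib[symmetric] by (intro sum.cong) (simp_all add: algebra_simps)
    also have "(\<Sum>k=0..n. ?S n k * ffact x (Suc k))
        = (\<Sum>k=0..Suc n. (if k = 0 then 0 else ?S n (k - 1)) * ffact x k)"
      by (subst sum.atLeast0_atMost_Suc_shift) simp
    also have "(\<Sum>k=0..n. (real k - real n * l) * ?S n k * ffact x k)
        = (\<Sum>k=0..Suc n. (real k - real n * l) * ?S n k * ffact x k)"
      by (simp add: zero)
    finally show ?case
      by (simp only: sum.distrib[symmetric] distrib_right[symmetric] deg_stirling2_rec.simps)
  qed
  with zero show ?thesis
    by (auto simp: is_deg_stirling2_def)
qed

lemma is_deg_stirling2_unique:
  assumes "is_deg_stirling2 l S" and "is_deg_stirling2 l T"
  shows "S = T"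
proof (intro ext)
  fix n k
  have van: "ffact (real j) i = 0" if "j < i" for i j
    using that by (auto simp: ffact_def)
  have pos: "ffact (real j) j \<noteq> 0" for j
    by (auto simp: ffact_def)
  show "S n k = T n k"
  proof (induction k rule: less_induct)
    case (less k)
    show ?case
    proof (cases "k \<le> n")
      case False
      then show ?thesis
        using assms by (simp add: is_deg_stirling2_def)
    next
      case True
      have split: "(\<Sum>i=0..n. U n i * ffact (real k) i)
          = (\<Sum>i<k. U n i * ffact (real k) i) + U n k * ffact (real k) k"
        for U :: "nat \<Rightarrow> nat \<Rightarrow> real"
      proof -
        have "(\<Sum>i=0..n. U n i * ffact (real k) i) = (\<Sum>i<Suc k. U n i * ffact (real k) i)"
          using True by (intro sum.mono_neutral_right) (auto simp: van)
        then show ?thesis by simp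
      qed
      have "(\<Sum>i=0..n. S n i * ffact (real k) i) = (\<Sum>i=0..n. T n i * ffact (real k) i)"
        using assms unfolding is_deg_stirling2_def by metis
      then show ?thesis
        unfolding split using less pos by simp
    qed
  qed
qed

lemma ex1_is_deg_stirling2: "\<exists>!S. is_deg_stirling2 l S"
  using is_deg_stirling2_rec is_deg_stirling2_unique by blast

end

theory Submission
  imports Defs
begin

text \<open>Both sides telescope to the sum of \<open>gen_ffact l j \<alpha>\<close> over \<open>\<alpha> \<le> j \<le> m\<close>.
  On the left this comes from \<open>dexp l (x + 1) = dexp l x * dexp l 1\<close>, which turns the difference
  of the Bernoulli generating functions at \<open>x + 1\<close> and \<open>x\<close> into \<open>t * dexp l x\<close>.
  On the right, Pascal's rule and absorption turn the difference of the binomial sums at \<open>n\<close> and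
  \<open>n - 1\<close> into \<open>1/n\<close> times \<open>gen_ffact l n (\<alpha> + 1) + \<alpha> * l * gen_ffact l n \<alpha>\<close>,
  expanded in falling factorials; this equals \<open>gen_ffact l n \<alpha>\<close>.\<close>

lemma gen_ffact_0 [simp]: "gen_ffact l x 0 = 1"
  by (simp add: gen_ffact_def)

lemma gen_ffact_Suc: "gen_ffact l x (Suc n) = gen_ffact l x n * (x - real n * l)"
  by (simp add: gen_ffact_def)

lemma dexp_nth_Suc:
  "real (Suc n) * fps_nth (dexp l x) (Suc n) = (x - real n * l) * fps_nth (dexp l x) n"
  by (simp add: dexp_def gen_ffact_Suc del: of_nat_Suc)

lemma fps_nth_linear_mult_deriv:
  fixes F :: "real fps"
  shows "fps_nth ((1 + fps_const l * fps_X) * fps_deriv F) n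
    = real (Suc n) * fps_nth F (Suc n) + real n * l * fps_nth F n"
  by (cases n) (simp_all add: algebra_simps)

text \<open>Formally \<open>dexp l x\<close> is (1 + l t)^(x/l), with logarithmic derivative x / (1
  + l t). Clearing the denominator gives a form that also covers \<open>l = 0\<close>.\<close>

lemma dexp_ode: "(1 + fps_const l * fps_X) * fps_deriv (dexp l x) = fps_const x * dexp l x"
  by (rule fps_ext) (simp only: fps_nth_linear_mult_deriv dexp_nth_Suc fps_mult_left_const_nth
      left_diff_distrib diff_add_cancel)

text \<open>The equation determines each coefficient from the previous one, because
  \<open>real (Suc n)\<close> can be cancelled.\<close>

lemma dexp_unique:
  assumes ode: "(1 + fps_const l * fps_X) * fps_deriv F = fps_const x * F"
    and init: "fps_nth F 0 = 1"
  shows "F = dexp l x"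
proof (rule fps_ext)
  fix n
  show "fps_nth F n = fps_nth (dexp l x) n"
  proof (induction n)
    case 0
    show ?case by (simp add: init dexp_def)
  next
    case (Suc n)
    have "real (Suc n) * fps_nth F (Suc n) = (x - real n * l) * fps_nth F n"
      using fps_nth_linear_mult_deriv[of l F n] by (simp add: ode left_diff_distrib)
    also have "\<dots> = real (Suc n) * fps_nth (dexp l x) (Suc n)"
      by (simp only: Suc dexp_nth_Suc)
    finally show ?case
      by (simp del: of_nat_Suc)
  qed
qed

text \<open>By the Leibniz rule the product satisfies the differential equation for
  \<open>x + y\<close>, so uniqueness applies and no Vandermonde-type convolution is needed.\<close>

lemma dexp_add: "dexp l (x + y) = dexp l x * dexp l y"
proof (rule dexp_unique[symmetric])
  let ?u = "1 + fps_const l * fps_X :: real fps"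
  have "?u * fps_deriv (dexp l x * dexp l y)
      = (?u * fps_deriv (dexp l x)) * dexp l y + dexp l x * (?u * fps_deriv (dexp l y))"
    by (simp add: algebra_simps)
  also have "\<dots> = fps_const (x + y) * (dexp l x * dexp l y)"
    unfolding dexp_ode by (simp add: algebra_simps flip: fps_const_add)
  finally show "?u * fps_deriv (dexp l x * dexp l y) = fps_const (x + y) * (dexp l x * dexp l y)" .
qed (simp add: dexp_def)

lemma deg_bernoulli_diff:
  "deg_bernoulli (Suc n) l (x + 1) - deg_bernoulli (Suc n) l x = real (Suc n) * gen_ffact l x n"
proof -
  let ?Q = "fps_X / (dexp l 1 - 1)"
  have "?Q * dexp l (x + 1) - ?Q * dexp l x = ?Q * (dexp l 1 - 1) * dexp l x"
    by (simp only: dexp_add right_diff_distrib left_diff_distrib mult_1_left mult_1_right mult_ac)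
  also have "\<dots> = fps_X * dexp l x"
    by (simp only: dexp_quotient_exact)
  \<comment> \<open>The factor \<open>fps_X\<close> shifts the index: coefficient
    \<open>Suc n\<close> of the product is coefficient \<open>n\<close> of
    \<open>dexp l x\<close>.\<close>
  finally have "fps_nth (?Q * dexp l (x + 1)) (Suc n) - fps_nth (?Q * dexp l x) (Suc n)
      = gen_ffact l x n / fact n"
    by (metis fps_sub_nth fps_X_mult_nth nat.distinct(1) diff_Suc_1 dexp_def fps_nth_Abs_fps)
  then have "fact (Suc n) * (fps_nth (?Q * dexp l (x + 1)) (Suc n)
      - fps_nth (?Q * dexp l x) (Suc n)) = real (Suc n) * gen_ffact l x n"
    by simp
  then show ?thesis
    by (simp only: deg_bernoulli_def right_diff_distrib)
qed

lemma is_deg_stirling2_deg_stirling2: "is_deg_stirling2 l (deg_stirling2 l)"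
  unfolding deg_stirling2_def by (rule theI'[OF ex1_is_deg_stirling2])

lemma deg_stirling2_eq_rec: "deg_stirling2 l = deg_stirling2_rec l"
  using is_deg_stirling2_deg_stirling2 is_deg_stirling2_rec by (rule is_deg_stirling2_unique)

lemma deg_stirling2_0_right:
  assumes "n > 0"
  shows "deg_stirling2 l n 0 = 0"
proof -
  \<comment> \<open>In column 0 the recurrence only multiplies by \<open>- real n * l\<close>, which
    vanishes at \<open>n = 0\<close>; the zero then propagates.\<close>
  have "deg_stirling2_rec l (Suc n) 0 = 0" for n
    by (induction n) simp_all
  then show ?thesis
    using assms by (cases n) (simp_all only: deg_stirling2_eq_rec less_irrefl)
qed

lemma ffact_of_nat: "ffact (real n) k = fact k * real (n choose k)"
  by (simp add: ffact_def binomial_gbinomial gbinomial_mult_fact atLeast0LessThan)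

text \<open>The summation bound can be moved from \<open>a\<close> to \<open>n\<close>: the Stirling
  numbers vanish for \<open>k > a\<close>, and \<open>ffact (real n) k\<close> vanishes for
  \<open>k > n\<close>.\<close>

lemma sum_deg_stirling2_ffact:
  "gen_ffact l (real n) a = (\<Sum>k\<le>n. deg_stirling2 l a k * ffact (real n) k)"
proof -
  have "gen_ffact l (real n) a = (\<Sum>k=0..a. deg_stirling2 l a k * ffact (real n) k)"
    using is_deg_stirling2_deg_stirling2 unfolding is_deg_stirling2_def by blast
  also have "\<dots> = (\<Sum>k\<le>max a n. deg_stirling2 l a k * ffact (real n) k)"
    using is_deg_stirling2_deg_stirling2[of l]
    by (intro sum.mono_neutral_left) (auto simp: is_deg_stirling2_def)
  also have "\<dots> = (\<Sum>k\<le>n. deg_stirling2 l a k * ffact (real n) k)"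
    by (intro sum.mono_neutral_right) (auto simp: ffact_of_nat)
  finally show ?thesis .
qed

lemma sum_choose_fact_Suc_diff:
  fixes c :: "nat \<Rightarrow> real"
  shows "real (Suc n) * ((\<Sum>k=1..Suc n. real (Suc n choose k) * fact (k - 1) * c k)
           - (\<Sum>k=1..n. real (n choose k) * fact (k - 1) * c k))
         = (\<Sum>k=1..Suc n. c k * ffact (real (Suc n)) k)"
proof -
  have absorb: "real (Suc n) * ((real (Suc n choose k) - real (n choose k)) * fact (k - 1))
      = ffact (real (Suc n)) k" if k: "k \<ge> 1" for k
  proof -
    obtain j where j: "k = Suc j"
      using k by (cases k) auto
    \<comment> \<open>After Pascal's rule only \<open>n choose j\<close> is left; absorption
      supplies the factor \<open>Suc j\<close> that completes \<open>fact j\<close> to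
      \<open>fact k\<close>.\<close>
    have "real (Suc n) * real (n choose j) = real (Suc n choose Suc j) * real (Suc j)"
      using Suc_times_binomial_eq[of n j] by (metis of_nat_mult)
    then show ?thesis
      by (simp add: j ffact_of_nat algebra_simps del: of_nat_Suc)
  qed
  \<comment> \<open>The added top term is zero since \<open>n choose Suc n = 0\<close>; both sums
    now have the same range.\<close>
  have "(\<Sum>k=1..n. real (n choose k) * fact (k - 1) * c k)
      = (\<Sum>k=1..Suc n. real (n choose k) * fact (k - 1) * c k)"
    by simp
  then have "real (Suc n) * ((\<Sum>k=1..Suc n. real (Suc n choose k) * fact (k - 1) * c k)
           - (\<Sum>k=1..n. real (n choose k) * fact (k - 1) * c k))
      = (\<Sum>k=1..Suc n.
          c k * (real (Suc n) * ((real (Suc n choose k) - real (n choose k)) * fact (k - 1))))"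
    by (simp only: sum_subtractf[symmetric] sum_distrib_left) (simp only: algebra_simps)
  also have "\<dots> = (\<Sum>k=1..Suc n. c k * ffact (real (Suc n)) k)"
    by (intro sum.cong refl) (simp only: absorb atLeastAtMost_iff)
  finally show ?thesis .
qed

lemma deg_stirling2_sum_diff:
  fixes l :: real and a :: nat
  defines "c \<equiv> \<lambda>k. deg_stirling2 l (a + 1) k + real a * l * deg_stirling2 l a k"
  shows "(\<Sum>k=1..Suc n. real (Suc n choose k) * fact (k - 1) * c k)
         - (\<Sum>k=1..n. real (n choose k) * fact (k - 1) * c k) = gen_ffact l (real (Suc n)) a"
    (is "?D = _")
proof -
  \<comment> \<open>This lets the sum start at 0. For \<open>a = 0\<close> the number
    \<open>deg_stirling2 l 0 0\<close> is 1, but its factor \<open>real a\<close> is zero.\<close>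
  have c0: "c 0 = 0"
    by (cases "a = 0") (simp_all add: c_def deg_stirling2_0_right)
  have "real (Suc n) * ?D = (\<Sum>k=1..Suc n. c k * ffact (real (Suc n)) k)"
    by (rule sum_choose_fact_Suc_diff)
  also have "\<dots> = (\<Sum>k\<le>Suc n. c k * ffact (real (Suc n)) k)"
    using c0 by (intro sum.mono_neutral_left) (auto simp: not_less_eq_eq)
  also have "\<dots> = gen_ffact l (real (Suc n)) (a + 1) + real a * l * gen_ffact l (real (Suc n)) a"
    by (simp only: c_def distrib_right sum.distrib sum_deg_stirling2_ffact sum_distrib_left
        mult.assoc)
  \<comment> \<open>The last factor of \<open>gen_ffact l (real (Suc n)) (a + 1)\<close> is
    \<open>real (Suc n) - real a * l\<close>; the correction term cancels its \<open>l\<close>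
    part.\<close>
  also have "\<dots> = real (Suc n) * gen_ffact l (real (Suc n)) a"
    by (simp add: gen_ffact_Suc algebra_simps)
  finally show ?thesis
    by (simp del: of_nat_Suc)
qed

theorem theorem4:
  fixes l :: real and \<alpha> m :: nat
  assumes "\<alpha> > 0" and "m \<ge> \<alpha>"
  shows "1 / real (\<alpha> + 1) *
           (deg_bernoulli (\<alpha> + 1) l (real (m + 1)) - deg_bernoulli (\<alpha> + 1) l (real \<alpha>))
         = (\<Sum>k=1..m. real (m choose k) * fact (k - 1) *
              (deg_stirling2 l (\<alpha> + 1) k + real \<alpha> * l * deg_stirling2 l \<alpha> k))
           - (\<Sum>k=1..\<alpha> - 1. real ((\<alpha> - 1) choose k) * fact (k - 1) *
              (deg_stirling2 l (\<alpha> + 1) k + real \<alpha> * l * deg_stirling2 l \<alpha> k))"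
proof -
  define B where "B x = 1 / real (\<alpha> + 1) * deg_bernoulli (\<alpha> + 1) l x" for x
  define F where "F n = (\<Sum>k=1..n. real (n choose k) * fact (k - 1) *
    (deg_stirling2 l (\<alpha> + 1) k + real \<alpha> * l * deg_stirling2 l \<alpha> k))" for n
  have B: "B (x + 1) - B x = gen_ffact l x \<alpha>" for x
    unfolding B_def right_diff_distrib[symmetric] Suc_eq_plus1[symmetric] deg_bernoulli_diff
    by (simp del: of_nat_Suc)
  have F: "F (Suc n) - F n = gen_ffact l (real (Suc n)) \<alpha>" for n
    unfolding F_def by (rule deg_stirling2_sum_diff)
  have "B (real (m + 1)) - B (real \<alpha>) = F m - F (\<alpha> - 1)"
    using assms(2)
  proof (induction m rule: dec_induct)
    \<comment> \<open>One increment on each side: \<open>\<alpha> > 0\<close> gives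
      \<open>Suc (\<alpha> - 1) = \<alpha>\<close>, so both equal
      \<open>gen_ffact l (real \<alpha>) \<alpha>\<close>.\<close>
    case base
    show ?case
      using B[of "real \<alpha>"] F[of "\<alpha> - 1"] assms(1) by (simp add: add.commute)
  next
    case (step n)
    then show ?case
      using B[of "real (Suc n)"] F[of n] by (simp add: add.commute)
  qed
  then show ?thesis
    unfolding B_def F_def by (simp only: right_diff_distrib)
qed

end
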